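(* Assume $\lambda\in\sigma_{ell}(J_T)$, $C(\lambda;T)\ne0$, $\alpha>\frac32$, and let $$u_n=\omega_n(\lambda)\,\mathrm{Im}(\varphi_n(\lambda))\quad\text{for } n\ge2,$$ $$q_n=-a_{n-1}\left(\mathrm{Im}(\varphi_{n-1}(\lambda))\right)^2\left(\frac{n^{-\alpha}}{\omega_n(\lambda)}\right)+a_n\left(\mathrm{Im}(\varphi_{n+1}(\lambda))\right)^2\left(\frac{(n+1)^{-\alpha}}{\omega_n(\lambda)}\right)\quad\text{for } n\ge3 .$$ Then it is possible to choose $u_1,q_1,q_2\in\mathbb{R}$ such that $\lambda\in\sigma_p(J_T+Q)$ (with $(u_n)_{n\ge1}$ a corresponding eigenvector), where $Q$ is the infinite diagonal matrix with entries $(q_n)$.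
   Context: Let $T\ge1$, $a_1,\dots,a_T>0$, extended periodically by $a_{n+T}=a_n$, so in particular $a_0=a_T$. $J_T$ is the $T$-periodic Jacobi operator on $l^2(\mathbb{N};\mathbb{C})$ with zero diagonal and off-diagonal entries $a_1,a_2,\dots$, i.e. $(J_Tu)_1=a_1u_2$ and $(J_Tu)_n=a_{n-1}u_{n-1}+a_nu_{n+1}$ for $n\ge2$. $\sigma_p$ denotes the point spectrum (set of eigenvalues). For $\lambda\in\mathbb{C}$ and $j\in\{1,\dots,T\}$ put $$B_j(\lambda)=\begin{pmatrix}0&1\\ -\frac{a_{j-1}}{a_j}&\frac{\lambda}{a_j}\end{pmatrix},\qquad M(\lambda)=B_T(\lambda)B_{T-1}(\lambda)\cdots B_1(\lambda)=\begin{pmatrix}m_{11}(\lambda)&m_{12}(\lambda)\\ m_{21}(\lambda)&m_{22}(\lambda)\end{pmatrix}.$$ $\sigma_{ell}(J_T)$ is the set of elliptic points, i.e. of those $\lambda\in\mathbb{C}$ for which $M(\lambda)$ has two distinct eigenvalues of modulus one; equivalently, the set of real $\lambda$ with $|\mathrm{Tr}\,M(\lambda)|<2$. For $\lambda\in\sigma_{ell}(J_T)$ the eigenvalues of $M(\lambda)$ are $\mu(\lambda)=e^{i\theta(\lambda)}$ and $e^{-i\theta(\lambda)}$ with $\theta(\lambda)$ real (the quasi-momentum), and $m_{12}(\lambda)\ne0$. Define $(\varphi_n(\lambda))_{n\ge0}$ by $\varphi_0=1$, $\varphi_1=(\mu-m_{11})/m_{12}$ and $a_{n-1}\varphi_{n-1}+a_n\varphi_{n+1}=\lambda\varphi_n$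 for $n\ge1$; it satisfies $\varphi_{T(k-1)+s}=\varphi_s e^{i(k-1)\theta(\lambda)}$ for $s\in\{0,\dots,T-1\}$, $k\ge1$. Further, $$C(\lambda;T)=\mathrm{Re}\left(\sum_{s=1}^{T}\varphi_s(\lambda)\overline{\varphi_{s-1}(\lambda)}\right),\qquad \omega_n(\lambda)=\sum_{m=n+1}^{\infty}m^{-\alpha}\,\mathrm{Im}(\varphi_m(\lambda))\,\mathrm{Im}(\varphi_{m-1}(\lambda)).$$ Convention on zeros of $\omega_n$ (no restriction on $\lambda$ or $\alpha$): since $C(\lambda;T)\ne0$, there is $L$ with $\omega_n\ne0$ for all $n\ge L$. If $\omega_n$ vanishes for some $n<L$, the definition of $\omega_n$ is changed by inserting a factor $c_m$ into the $m$-th term of the sum, where $c_m=1$ for all $m\ge L$ and $c_1,\dots,c_{L-1}$ are real numbers chosen so that $\omega_n\neq0$ for all $n\ge1$ (such a choice is possible, increasing $L$ if necessary); in the formula for $q_n$ the factors $n^{-\alpha}$ and $(n+1)^{-\alpha}$ are then replaced by $c_nn^{-\alpha}$ and $c_{n+1}(n+1)^{-\alpha}$. *)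

theory Defs
  imports Complex_Main "Jordan_Normal_Form.Char_Poly"
begin

text \<open>Sequences indexed by the positive integers are functions on \<^typ>\<open>nat\<close> that vanish at
  index 0, so that equality of sequences is equality of functions.\<close>

definition l2 :: "(nat \<Rightarrow> complex) set" where
  "l2 = {u. u 0 = 0 \<and> summable (\<lambda>n. (cmod (u n))\<^sup>2)}"

definition jacobi :: "(nat \<Rightarrow> real) \<Rightarrow> (nat \<Rightarrow> complex) \<Rightarrow> nat \<Rightarrow> complex" where
  "jacobi a u n =
     (if n = 0 then 0
      else if n = 1 then of_real (a 1) * u 2
      else of_real (a (n - 1)) * u (n - 1) + of_real (a n) * u (n + 1))"

definition diag_op :: "(nat \<Rightarrow> real) \<Rightarrow> (nat \<Rightarrow> complex) \<Rightarrow> nat \<Rightarrow> complex" where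
  "diag_op q u n = of_real (q n) * u n"

definition perturbed_jacobi ::
    "(nat \<Rightarrow> real) \<Rightarrow> (nat \<Rightarrow> real) \<Rightarrow> (nat \<Rightarrow> complex) \<Rightarrow> nat \<Rightarrow> complex" where
  "perturbed_jacobi a q u n = jacobi a u n + diag_op q u n"

text \<open>The domain of \<open>A\<close> is \<open>{u \<in> l2. A u \<in> l2}\<close>; an eigenvector lies in it automatically, because
  \<open>A u\<close> is a multiple of \<open>u\<close>.\<close>

definition l2_eigenvector ::
    "((nat \<Rightarrow> complex) \<Rightarrow> nat \<Rightarrow> complex) \<Rightarrow> (nat \<Rightarrow> complex) \<Rightarrow> complex \<Rightarrow> bool" where
  "l2_eigenvector A u k \<longleftrightarrow> u \<in> l2 \<and> u \<noteq> (\<lambda>_. 0) \<and> A u = (\<lambda>n. k * u n)"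

definition point_spectrum :: "((nat \<Rightarrow> complex) \<Rightarrow> nat \<Rightarrow> complex) \<Rightarrow> complex set" where
  "point_spectrum A = {k. \<exists>u. l2_eigenvector A u k}"

definition transfer_mat :: "(nat \<Rightarrow> real) \<Rightarrow> complex \<Rightarrow> nat \<Rightarrow> complex mat" where
  "transfer_mat a lam j = mat_of_rows_list 2
     [[0, 1],
      [- (of_real (a (j - 1)) / of_real (a j)), lam / of_real (a j)]]"

fun transfer_prod :: "(nat \<Rightarrow> real) \<Rightarrow> complex \<Rightarrow> nat \<Rightarrow> complex mat" where
  "transfer_prod a lam 0 = 1\<^sub>m 2"
| "transfer_prod a lam (Suc j) = transfer_mat a lam (Suc j) * transfer_prod a lam j"

definition monodromy :: "(nat \<Rightarrow> real) \<Rightarrow> nat \<Rightarrow> complex \<Rightarrow> complex mat" where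
  "monodromy a T lam = transfer_prod a lam T"

definition elliptic_points :: "(nat \<Rightarrow> real) \<Rightarrow> nat \<Rightarrow> complex set" where
  "elliptic_points a T =
     {lam. \<exists>k1 k2. k1 \<noteq> k2 \<and> cmod k1 = 1 \<and> cmod k2 = 1 \<and>
        eigenvalue (monodromy a T lam) k1 \<and> eigenvalue (monodromy a T lam) k2}"

definition quasi_momentum :: "(nat \<Rightarrow> real) \<Rightarrow> nat \<Rightarrow> complex \<Rightarrow> real \<Rightarrow> bool" where
  "quasi_momentum a T lam \<theta> \<longleftrightarrow>
     {k. eigenvalue (monodromy a T lam) k} = {cis \<theta>, cis (- \<theta>)}"

text \<open>Matrix indices start at 0: the entries \<open>(0, 0)\<close> and \<open>(0, 1)\<close> are $m_{11}$ and $m_{12}$.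
  The last equation is $a_{n-1}\varphi_{n-1} + a_n\varphi_{n+1} = \lambda\varphi_n$ solved for
  $\varphi_{n+1}$.\<close>

fun bloch :: "(nat \<Rightarrow> real) \<Rightarrow> nat \<Rightarrow> complex \<Rightarrow> real \<Rightarrow> nat \<Rightarrow> complex" where
  "bloch a T lam \<theta> 0 = 1"
| "bloch a T lam \<theta> (Suc 0) =
     (cis \<theta> - monodromy a T lam $$ (0, 0)) / monodromy a T lam $$ (0, 1)"
| "bloch a T lam \<theta> (Suc (Suc n)) =
     (lam * bloch a T lam \<theta> (Suc n) - of_real (a n) * bloch a T lam \<theta> n) / of_real (a (Suc n))"

definition C_coeff :: "(nat \<Rightarrow> complex) \<Rightarrow> nat \<Rightarrow> real" where
  "C_coeff \<phi> T = Re (\<Sum>s = 1..T. \<phi> s * cnj (\<phi> (s - 1)))"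

text \<open>The sum $\sum_{m=n+1}^\infty c_m m^{-\alpha}\,\mathrm{Im}\,\varphi_m\,\mathrm{Im}\,\varphi_{m-1}$,
  with $m = n + 1 + k$. The unmodified $\omega_n$ has all $c_m = 1$.\<close>

definition omega :: "(nat \<Rightarrow> real) \<Rightarrow> real \<Rightarrow> (nat \<Rightarrow> complex) \<Rightarrow> nat \<Rightarrow> real" where
  "omega c \<alpha> \<phi> n =
     (\<Sum>k. c (n + 1 + k) * real (n + 1 + k) powr (- \<alpha>) * Im (\<phi> (n + 1 + k)) * Im (\<phi> (n + k)))"

text \<open>The convention on zeros of $\omega_n$: no factors are inserted unless some $\omega_n$ with
  $n \ge 1$ vanishes.\<close>

definition admissible_factors :: "real \<Rightarrow> (nat \<Rightarrow> complex) \<Rightarrow> (nat \<Rightarrow> real) \<Rightarrow> bool" where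
  "admissible_factors \<alpha> \<phi> c \<longleftrightarrow>
     (if \<forall>n\<ge>1. omega (\<lambda>_. 1) \<alpha> \<phi> n \<noteq> 0 then c = (\<lambda>_. 1)
      else \<exists>L. (\<forall>n\<ge>L. omega (\<lambda>_. 1) \<alpha> \<phi> n \<noteq> 0) \<and> (\<forall>m\<ge>L. c m = 1) \<and>
               (\<forall>n\<ge>1. omega c \<alpha> \<phi> n \<noteq> 0))"

definition u_seq ::
    "(nat \<Rightarrow> real) \<Rightarrow> real \<Rightarrow> (nat \<Rightarrow> complex) \<Rightarrow> real \<Rightarrow> nat \<Rightarrow> complex" where
  "u_seq c \<alpha> \<phi> u1 n =
     (if n = 0 then 0 else if n = 1 then of_real u1
      else of_real (omega c \<alpha> \<phi> n * Im (\<phi> n)))"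

definition q_seq ::
    "(nat \<Rightarrow> real) \<Rightarrow> (nat \<Rightarrow> real) \<Rightarrow> real \<Rightarrow> (nat \<Rightarrow> complex) \<Rightarrow> real \<Rightarrow> real \<Rightarrow> nat \<Rightarrow> real" where
  "q_seq a c \<alpha> \<phi> q1 q2 n =
     (if n = 0 then 0 else if n = 1 then q1 else if n = 2 then q2
      else - a (n - 1) * (Im (\<phi> (n - 1)))\<^sup>2 * (c n * real n powr (- \<alpha>) / omega c \<alpha> \<phi> n)
           + a n * (Im (\<phi> (n + 1)))\<^sup>2 *
               (c (n + 1) * real (n + 1) powr (- \<alpha>) / omega c \<alpha> \<phi> n))"

end

theory Submission
  imports Defs "HOL-Analysis.Summation_Tests" "HOL-Real_Asymp.Real_Asymp"
begin

text \<open>Floquet theory forces \<open>lam\<close> to be real and gives the Bloch relation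
  $\varphi_{n+T} = e^{i\theta}\varphi_n$. Since
  $2\,\mathrm{Im}\,\varphi_m\,\mathrm{Im}\,\varphi_{m-1} =
   \mathrm{Re}(\varphi_m\overline{\varphi_{m-1}}) - \mathrm{Re}(\varphi_m\varphi_{m-1})$,
  where the first term adds up to $C$ over each period and the partial sums of the second one are
  bounded (they pick up the factor $e^{2i\theta} \neq 1$ over each period), the partial sums of
  the left-hand side are $(C/T)n + O(1)$. Summation by parts then shows $\omega_n \neq 0$ for
  large $n$, while trivially $\omega_n = O(n^{1-\alpha})$, which is square summable because
  $\alpha > 3/2$. The eigenvalue equation for $n \ge 3$ is an identity, obtained by expressing
  $\omega_{n\pm 1}$ through $\omega_n$; the free parameters $u_1, q_1, q_2$ solve it for
  $n \le 2$.\<close>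

section \<open>Three-term recurrences and Floquet solutions\<close>

definition three_term :: "(nat \<Rightarrow> real) \<Rightarrow> complex \<Rightarrow> (nat \<Rightarrow> complex) \<Rightarrow> bool" where
  "three_term a lam \<psi> \<longleftrightarrow>
     (\<forall>n. of_real (a n) * \<psi> n + of_real (a (Suc n)) * \<psi> (n + 2) = lam * \<psi> (Suc n))"

text \<open>\<open>bloch\<close> divides by the upper right entry of the monodromy matrix, which is
  known to be nonzero only once \<open>lam\<close> is real. The proof of reality therefore works
  with solutions having arbitrary initial data.\<close>

fun recurrence_sol ::
    "(nat \<Rightarrow> real) \<Rightarrow> complex \<Rightarrow> complex \<Rightarrow> complex \<Rightarrow> nat \<Rightarrow> complex" where
  "recurrence_sol a lam x y 0 = x"
| "recurrence_sol a lam x y (Suc 0) = y"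
| "recurrence_sol a lam x y (Suc (Suc n)) =
     (lam * recurrence_sol a lam x y (Suc n) - of_real (a n) * recurrence_sol a lam x y n)
       / of_real (a (Suc n))"

lemma three_term_recurrence_sol:
  assumes "\<And>n. a n \<noteq> 0"
  shows "three_term a lam (recurrence_sol a lam x y)"
  using assms by (simp add: three_term_def)

lemma three_term_bloch:
  assumes "\<And>n. a n \<noteq> 0"
  shows "three_term a lam (bloch a T lam \<theta>)"
  using assms by (simp add: three_term_def)

section \<open>Entries of transfer matrix products\<close>

lemma transfer_mat_carrier: "transfer_mat a lam j \<in> carrier_mat 2 2"
  by (rule carrier_matI) (simp_all add: transfer_mat_def mat_of_rows_list_def)

lemma transfer_prod_carrier: "transfer_prod a lam n \<in> carrier_mat 2 2"
  by (induction n) (auto intro: mult_carrier_mat transfer_mat_carrier)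

lemma transfer_prod_Suc_entries:
  assumes "j < 2"
  shows "transfer_prod a lam (Suc n) $$ (0, j) = transfer_prod a lam n $$ (1, j)"
    and "transfer_prod a lam (Suc n) $$ (1, j) =
      - (of_real (a n) / of_real (a (Suc n))) * transfer_prod a lam n $$ (0, j)
      + lam / of_real (a (Suc n)) * transfer_prod a lam n $$ (1, j)"
proof -
  have dim: "dim_row (transfer_prod a lam n) = 2" "dim_col (transfer_prod a lam n) = 2"
    using carrier_matD[OF transfer_prod_carrier] by blast+
  show "transfer_prod a lam (Suc n) $$ (0, j) = transfer_prod a lam n $$ (1, j)"
    using assms dim
    by (simp add: transfer_mat_def mat_of_rows_list_def scalar_prod_def numeral_2_eq_2)
  show "transfer_prod a lam (Suc n) $$ (1, j) =
      - (of_real (a n) / of_real (a (Suc n))) * transfer_prod a lam n $$ (0, j)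
      + lam / of_real (a (Suc n)) * transfer_prod a lam n $$ (1, j)"
    using assms dim
    by (simp add: transfer_mat_def mat_of_rows_list_def scalar_prod_def numeral_2_eq_2)
qed

text \<open>Each transfer matrix advances a pair of neighbouring values by one site. At
  \<open>n = T\<close> this turns statements about the monodromy matrix into statements about
  solutions.\<close>

lemma transfer_prod_three_term:
  assumes "three_term a lam \<psi>" and "\<And>n. a n \<noteq> 0"
  shows "transfer_prod a lam n $$ (0, 0) * \<psi> 0 + transfer_prod a lam n $$ (0, 1) * \<psi> 1 = \<psi> n
    \<and> transfer_prod a lam n $$ (1, 0) * \<psi> 0 + transfer_prod a lam n $$ (1, 1) * \<psi> 1 = \<psi> (Suc n)"
proof (induction n)
  case 0
  then show ?case by simp
next
  case (Suc n)
  have rec: "\<psi> (Suc (Suc n)) = (lam * \<psi> (Suc n) - of_real (a n) * \<psi> n) / of_real (a (Suc n))"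
    using assms by (simp add: three_term_def field_simps)
  note e = transfer_prod_Suc_entries[where a = a and lam = lam and n = n]
  have less: "0 < (2::nat)" "1 < (2::nat)" by simp_all
  have "transfer_prod a lam (Suc n) $$ (1, 0) * \<psi> 0 + transfer_prod a lam (Suc n) $$ (1, 1) * \<psi> 1
     = - (of_real (a n) / of_real (a (Suc n))) * (transfer_prod a lam n $$ (0, 0) * \<psi> 0 + transfer_prod a lam n $$ (0, 1) * \<psi> 1)
      + lam / of_real (a (Suc n)) * (transfer_prod a lam n $$ (1, 0) * \<psi> 0 + transfer_prod a lam n $$ (1, 1) * \<psi> 1)"
    unfolding e(2)[OF less(1)] e(2)[OF less(2)] by (simp add: algebra_simps)
  also have "\<dots> = \<psi> (Suc (Suc n))"
    using Suc by (simp add: rec diff_divide_distrib)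
  finally show ?case
    using Suc unfolding e(1)[OF less(1)] e(1)[OF less(2)] by simp
qed

lemma transfer_prod_real:
  assumes "lam \<in> \<real>" and "i < 2" and "j < 2"
  shows "transfer_prod a lam n $$ (i, j) \<in> \<real>"
  using assms(2)
proof (induction n arbitrary: i)
  case 0
  then show ?case using assms by simp
next
  case (Suc n)
  then have "i = 0 \<or> i = 1" by auto
  then show ?case
    using Suc.IH[of 0] Suc.IH[of 1] assms transfer_prod_Suc_entries[of j a lam n]
    by (auto simp del: transfer_prod.simps intro!: Reals_add Reals_mult Reals_divide Reals_minus)
qed

section \<open>Eigenvalues of two-by-two matrices\<close>

lemma eigenvalue_2x2:
  fixes A :: "complex mat"
  assumes A: "A \<in> carrier_mat 2 2" and k: "eigenvalue A k"
  obtains x y where "(x, y) \<noteq> (0, 0)"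
    and "A $$ (0, 0) * x + A $$ (0, 1) * y = k * x"
    and "A $$ (1, 0) * x + A $$ (1, 1) * y = k * y"
proof -
  obtain v where v: "v \<in> carrier_vec 2" "v \<noteq> 0\<^sub>v 2" "A *\<^sub>v v = k \<cdot>\<^sub>v v"
    using A k by (auto simp: eigenvalue_def eigenvector_def)
  have "(A *\<^sub>v v) $ i = k * v $ i" if "i < 2" for i
    using v that by simp
  moreover have "(A *\<^sub>v v) $ i = A $$ (i, 0) * v $ 0 + A $$ (i, 1) * v $ 1" if "i < 2" for i
    using A v(1) that by (simp add: scalar_prod_def numeral_2_eq_2)
  ultimately have eq: "A $$ (i, 0) * v $ 0 + A $$ (i, 1) * v $ 1 = k * v $ i" if "i < 2" for i
    using that by metis
  have "(v $ 0, v $ 1) \<noteq> (0, 0)"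
  proof
    assume "(v $ 0, v $ 1) = (0, 0)"
    then have "v = 0\<^sub>v 2"
      using v(1) by (intro eq_vecI) (auto simp: less_2_cases_iff)
    with v(2) show False by simp
  qed
  then show thesis using that[of "v $ 0" "v $ 1"] eq[of 0] eq[of 1] by simp
qed

lemma eigenvalue_2x2_char:
  fixes A :: "complex mat"
  assumes "A \<in> carrier_mat 2 2" and "eigenvalue A k"
  shows "(A $$ (0, 0) - k) * (A $$ (1, 1) - k) = A $$ (0, 1) * A $$ (1, 0)"
proof -
  obtain x y where nz: "(x, y) \<noteq> (0, 0)"
    and 1: "A $$ (0, 0) * x + A $$ (0, 1) * y = k * x"
    and 2: "A $$ (1, 0) * x + A $$ (1, 1) * y = k * y"
    using eigenvalue_2x2[OF assms] .
  \<comment> \<open>Multiplying the eigenvector equations by the adjugate of \<open>A - k\<close>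
    shows that the determinant of \<open>A - k\<close> annihilates both coordinates, one of which is
    nonzero.\<close>
  have elim: "((p - k) * (r - k) - q * t) * x = 0 \<and> ((p - k) * (r - k) - q * t) * y = 0"
    if "p * x + q * y = k * x" "t * x + r * y = k * y" for p q r t :: complex
  proof
    have "((p - k) * (r - k) - q * t) * x = (r - k) * (p * x + q * y - k * x) - q * (t * x + r * y - k * y)"
      by (simp add: algebra_simps)
    then show "((p - k) * (r - k) - q * t) * x = 0" using that by simp
    have "((p - k) * (r - k) - q * t) * y = (p - k) * (t * x + r * y - k * y) - t * (p * x + q * y - k * x)"
      by (simp add: algebra_simps)
    then show "((p - k) * (r - k) - q * t) * y = 0" using that by simp
  qed
  show ?thesis using elim[OF 1 2] nz by auto
qed

text \<open>The shifted sequence satisfies the same second-order recurrence, because the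
  coefficients are periodic, and agrees with the multiple of \<open>\<psi>\<close> at two
  consecutive indices. The induction hence carries two values.\<close>

lemma three_term_floquet:
  assumes tt: "three_term a lam \<psi>" and nz: "\<And>n. a n \<noteq> 0" and per: "\<And>n. a (n + T) = a n"
    and "\<psi> T = \<mu> * \<psi> 0" and "\<psi> (Suc T) = \<mu> * \<psi> 1"
  shows "\<psi> (n + T) = \<mu> * \<psi> n"
proof -
  have "\<psi> (n + T) = \<mu> * \<psi> n \<and> \<psi> (Suc n + T) = \<mu> * \<psi> (Suc n)"
  proof (induction n)
    case 0
    then show ?case using assms by simp
  next
    case (Suc n)
    have "of_real (a (Suc n)) * \<psi> (Suc (Suc n) + T) = lam * \<psi> (Suc n + T) - of_real (a n) * \<psi> (n + T)"
      using tt[unfolded three_term_def, rule_format, of "n + T"] per[of n] per[of "Suc n"]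
      by (simp add: algebra_simps)
    also have "\<dots> = \<mu> * (lam * \<psi> (Suc n) - of_real (a n) * \<psi> n)"
      using Suc by (simp add: algebra_simps)
    also have "lam * \<psi> (Suc n) - of_real (a n) * \<psi> n = of_real (a (Suc n)) * \<psi> (Suc (Suc n))"
      using tt[unfolded three_term_def, rule_format, of n] by (simp add: algebra_simps)
    finally show ?case using Suc nz[of "Suc n"] by simp
  qed
  then show ?thesis ..
qed

text \<open>The Wronskian of \<open>\<psi>\<close> and its conjugate is periodic, but its increments are
  $\mathrm{Im}\,\lambda\,|\psi_{n+1}|^2$.\<close>

lemma floquet_unimodular_imp_real:
  assumes tt: "three_term a lam \<psi>" and per: "\<And>n. a (n + T) = a n" and "T \<ge> 1"
    and fl: "\<And>n. \<psi> (n + T) = \<mu> * \<psi> n" and "cmod \<mu> = 1" and "(\<psi> 0, \<psi> 1) \<noteq> (0, 0)"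
  shows "lam \<in> \<real>"
proof -
  define W where "W n = a n * Im (\<psi> (Suc n) * cnj (\<psi> n))" for n
  have step: "W (Suc n) - W n = Im lam * (cmod (\<psi> (Suc n)))\<^sup>2" for n
  proof -
    have r: "of_real (a (Suc n)) * \<psi> (n + 2) = lam * \<psi> (Suc n) - of_real (a n) * \<psi> n"
      using tt[unfolded three_term_def, rule_format, of n] by (simp add: algebra_simps)
    have "W (Suc n) = Im ((of_real (a (Suc n)) * \<psi> (n + 2)) * cnj (\<psi> (Suc n)))"
      by (simp add: W_def algebra_simps)
    then show ?thesis
      unfolding r cmod_power2 by (simp add: W_def algebra_simps power2_eq_square)
  qed
  have "cmod \<mu> ^ 2 = 1" using assms by simp
  then have "\<mu> * cnj \<mu> = 1" by (metis complex_norm_square of_real_1)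
  moreover have "\<psi> (Suc n + T) * cnj (\<psi> (n + T)) = (\<mu> * cnj \<mu>) * (\<psi> (Suc n) * cnj (\<psi> n))" for n
    by (simp only: fl complex_cnj_mult) (simp add: mult_ac)
  ultimately have W_per: "W (n + T) = W n" for n
    by (simp add: W_def per del: times_complex.sel)
  show ?thesis
  proof (rule ccontr)
    assume "lam \<notin> \<real>"
    then have im: "Im lam \<noteq> 0" by (simp add: complex_is_Real_iff)
    \<comment> \<open>The increments over a full period add up to zero and all have the sign of
      \<open>Im lam\<close>, so each of them vanishes.\<close>
    have zero: "\<psi> (Suc n) = 0" for n
    proof -
      have "(\<Sum>k<T. W (Suc (n + k)) - W (n + k)) = W (n + T) - W n"
        using sum_lessThan_telescope[of "\<lambda>k. W (n + k)" T] by simp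
      then have "Im lam * (\<Sum>k<T. (cmod (\<psi> (Suc (n + k))))\<^sup>2) = 0"
        using W_per by (simp add: step sum_distrib_left)
      then have "(\<Sum>k<T. (cmod (\<psi> (Suc (n + k))))\<^sup>2) = 0" using im by simp
      then have "\<forall>k\<in>{..<T}. (cmod (\<psi> (Suc (n + k))))\<^sup>2 = 0"
        by (subst (asm) sum_nonneg_eq_0_iff) auto
      then show ?thesis using \<open>T \<ge> 1\<close> by (auto dest: bspec[of _ _ 0])
    qed
    \<comment> \<open>The increments see \<open>\<psi>\<close> only from index 1 on; index 0 is
      reached by moving one period ahead.\<close>
    have "\<mu> * \<psi> 0 = 0" using fl[of 0] zero[of "T - 1"] \<open>T \<ge> 1\<close> by simp
    then have "\<psi> 0 = 0" using \<open>cmod \<mu> = 1\<close> by auto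
    with zero[of 0] assms show False by simp
  qed
qed

text \<open>An eigenvector of the monodromy matrix, used as initial data, generates a Floquet
  solution with multiplier \<open>k\<close>, to which the Wronskian argument applies.\<close>

lemma unimodular_eigenvalue_imp_real:
  assumes nz: "\<And>n. a n \<noteq> 0" and per: "\<And>n. a (n + T) = a n" and "T \<ge> 1"
    and ev: "eigenvalue (monodromy a T lam) k" and "cmod k = 1"
  shows "lam \<in> \<real>"
proof -
  obtain x y where xy: "(x, y) \<noteq> (0, 0)"
    and 1: "monodromy a T lam $$ (0, 0) * x + monodromy a T lam $$ (0, 1) * y = k * x"
    and 2: "monodromy a T lam $$ (1, 0) * x + monodromy a T lam $$ (1, 1) * y = k * y"
    using eigenvalue_2x2[OF _ ev] transfer_prod_carrier unfolding monodromy_def by metis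
  let ?\<psi> = "recurrence_sol a lam x y"
  have tt: "three_term a lam ?\<psi>" using nz by (rule three_term_recurrence_sol)
  have "?\<psi> T = k * ?\<psi> 0" "?\<psi> (Suc T) = k * ?\<psi> 1"
    using transfer_prod_three_term[OF tt nz, of T] 1 2 by (simp_all add: monodromy_def)
  then have "?\<psi> (n + T) = k * ?\<psi> n" for n
    using three_term_floquet[OF tt nz per] by blast
  then show ?thesis
    using floquet_unimodular_imp_real[where \<mu> = k, OF tt per \<open>T \<ge> 1\<close>] xy \<open>cmod k = 1\<close> by simp
qed

text \<open>Reality of \<open>lam\<close> comes first: it makes the monodromy matrix real, whereas
  \<open>cis \<theta>\<close> is not real. This yields a nonzero upper right entry, so that the
  quotient defining the Bloch solution at index 1 is a genuine one.\<close>

lemma elliptic_bloch: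
  assumes nz: "\<And>n. a n \<noteq> 0" and per: "\<And>n. a (n + T) = a n" and "T \<ge> 1"
    and ell: "lam \<in> elliptic_points a T" and qm: "quasi_momentum a T lam \<theta>"
  shows "lam \<in> \<real>" and "cis \<theta> * cis \<theta> \<noteq> 1"
    and "bloch a T lam \<theta> (n + T) = cis \<theta> * bloch a T lam \<theta> n"
    and "Im (bloch a T lam \<theta> 1) \<noteq> 0"
proof -
  let ?M = "monodromy a T lam"
  obtain k1 k2 where k: "k1 \<noteq> k2" "eigenvalue ?M k1" "eigenvalue ?M k2" "cmod k1 = 1"
    using ell by (auto simp: elliptic_points_def)
  show real: "lam \<in> \<real>" using unimodular_eigenvalue_imp_real[where a = a, OF nz per \<open>T \<ge> 1\<close>] k by blast
  have set: "{k. eigenvalue ?M k} = {cis \<theta>, cis (- \<theta>)}" using qm by (simp add: quasi_momentum_def)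
  \<comment> \<open>Two distinct eigenvalues do not fit into a singleton.\<close>
  with k have ne: "cis \<theta> \<noteq> cis (- \<theta>)" by (metis insert_iff mem_Collect_eq singletonD)
  then show "cis \<theta> * cis \<theta> \<noteq> 1"
    by (metis cis_inverse inverse_unique)
  have sin: "sin \<theta> \<noteq> 0" using ne by (auto simp: complex_eq_iff)
  have M: "?M \<in> carrier_mat 2 2" by (simp add: monodromy_def transfer_prod_carrier)
  have ev: "eigenvalue ?M (cis \<theta>)" using set by blast
  have char: "(?M $$ (0, 0) - cis \<theta>) * (?M $$ (1, 1) - cis \<theta>) = ?M $$ (0, 1) * ?M $$ (1, 0)"
    using eigenvalue_2x2_char[OF M ev] .
  have Mreal: "?M $$ (i, j) \<in> \<real>" if "i < 2" "j < 2" for i j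
    using transfer_prod_real[OF real that] by (simp add: monodromy_def)
  have nr: "x - cis \<theta> \<noteq> 0" if "x \<in> \<real>" for x
    using that sin by (auto simp: complex_is_Real_iff)
  \<comment> \<open>Otherwise the characteristic equation would make a product of two non-real
    numbers vanish.\<close>
  have m12: "?M $$ (0, 1) \<noteq> 0" using char nr Mreal by auto
  let ?\<phi> = "bloch a T lam \<theta>"
  have \<phi>1: "?M $$ (0, 1) * ?\<phi> 1 = cis \<theta> - ?M $$ (0, 0)" using m12 by simp
  have tt: "three_term a lam ?\<phi>" using nz by (rule three_term_bloch)
  have "?\<phi> T = cis \<theta> * ?\<phi> 0"
    using transfer_prod_three_term[OF tt nz, of T] \<phi>1
    by (simp only: monodromy_def) simp
  \<comment> \<open>Multiplying by the upper right entry clears the quotient in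
    \<open>?\<phi> 1\<close> and lets the characteristic equation enter.\<close>
  moreover have "?M $$ (0, 1) * ?\<phi> (Suc T) = ?M $$ (0, 1) * (cis \<theta> * ?\<phi> 1)"
  proof -
    have "?\<phi> (Suc T) = ?M $$ (1, 0) + ?M $$ (1, 1) * ?\<phi> 1"
      using transfer_prod_three_term[OF tt nz, of T] by (simp add: monodromy_def)
    then have "?M $$ (0, 1) * ?\<phi> (Suc T)
        = ?M $$ (0, 1) * ?M $$ (1, 0) + ?M $$ (1, 1) * (?M $$ (0, 1) * ?\<phi> 1)"
      by (simp only: algebra_simps)
    also have "\<dots> = cis \<theta> * (cis \<theta> - ?M $$ (0, 0))"
      unfolding char[symmetric] \<phi>1 by (simp add: algebra_simps)
    also have "\<dots> = ?M $$ (0, 1) * (cis \<theta> * ?\<phi> 1)"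
      unfolding \<phi>1[symmetric] by (simp only: mult_ac)
    finally show ?thesis .
  qed
  then have "?\<phi> (Suc T) = cis \<theta> * ?\<phi> 1" using m12 mult_left_cancel by blast
  ultimately show "?\<phi> (n + T) = cis \<theta> * ?\<phi> n"
    by (rule three_term_floquet[OF tt nz per])
  show "Im (?\<phi> 1) \<noteq> 0"
  proof
    assume "Im (?\<phi> 1) = 0"
    then have "?\<phi> 1 \<in> \<real>" by (simp add: complex_is_Real_iff)
    then have "?M $$ (0, 1) * ?\<phi> 1 + ?M $$ (0, 0) \<in> \<real>" using Mreal by (intro Reals_add Reals_mult) auto
    with \<phi>1 have "cis \<theta> \<in> \<real>" by (simp del: bloch.simps)
    then show False using nr by fastforce
  qed
qed

section \<open>Partial sums over a Floquet solution\<close>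

lemma periodic_bounded:
  fixes f :: "nat \<Rightarrow> real"
  assumes "T \<ge> 1" and per: "\<And>n. f (n + T) = f n"
  obtains B where "\<And>n. \<bar>f n\<bar> \<le> B"
proof
  fix n
  have "f n = f (n mod T)"
  proof (induction n rule: less_induct)
    case (less n)
    show ?case
    proof (cases "n < T")
      case False
      then have "f n = f (n - T)" using per[of "n - T"] by simp
      also have "\<dots> = f ((n - T) mod T)" using less[of "n - T"] False \<open>T \<ge> 1\<close> by simp
      finally show ?thesis using False by (simp add: le_mod_geq)
    qed simp
  qed
  then show "\<bar>f n\<bar> \<le> (\<Sum>k<T. \<bar>f k\<bar>)"
    using member_le_sum[of "n mod T" "{..<T}" "\<lambda>k. \<bar>f k\<bar>"] \<open>T \<ge> 1\<close> by simp
qed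

text \<open>Applied with \<open>r = 1\<close> to the products with a conjugate, and with
  \<open>r = \<mu> * \<mu>\<close> to the products without one.\<close>

lemma sum_shift_period:
  fixes f :: "nat \<Rightarrow> 'a::comm_ring_1"
  assumes "\<And>n. f (n + T) = r * f n"
  shows "sum f {..<n + T} = sum f {..<T} + r * sum f {..<n}"
  by (induction n) (simp_all add: assms algebra_simps)

lemma floquet_bounded:
  fixes \<phi> :: "nat \<Rightarrow> complex"
  assumes "T \<ge> 1" and fl: "\<And>n. \<phi> (n + T) = \<mu> * \<phi> n" and "cmod \<mu> = 1"
  obtains B where "\<And>n. cmod (\<phi> n) \<le> B"
proof -
  have "cmod (\<phi> (n + T)) = cmod (\<phi> n)" for n using assms by (simp add: norm_mult)
  from periodic_bounded[where f = "\<lambda>n. cmod (\<phi> n)", OF \<open>T \<ge> 1\<close> this] that show ?thesis by auto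
qed

lemma floquet_im_partial_sums:
  assumes "T \<ge> 1" and fl: "\<And>n. \<phi> (n + T) = \<mu> * \<phi> n" and "cmod \<mu> = 1" and "\<mu> * \<mu> \<noteq> 1"
  obtains B where
    "\<And>n. \<bar>(\<Sum>m<n. Im (\<phi> (Suc m)) * Im (\<phi> m) - C_coeff \<phi> T / (2 * real T))\<bar> \<le> B"
proof -
  define E where "E n = (\<Sum>m<n. Re (\<phi> (Suc m) * cnj (\<phi> m)))" for n
  define H where "H n = (\<Sum>m<n. \<phi> (Suc m) * \<phi> m)" for n
  \<comment> \<open>The fixed point of the affine map sending \<open>H n\<close> to
    \<open>H (n + T)\<close>. Relative to \<open>h\<close>, a shift by one period is multiplication
    by a unimodular number.\<close>
  define h where "h = H T / (1 - \<mu> * \<mu>)"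
  have mu: "\<mu> * cnj \<mu> = 1"
    using \<open>cmod \<mu> = 1\<close> by (metis complex_norm_square of_real_1 one_power2)
  have "\<phi> (Suc (m + T)) * cnj (\<phi> (m + T)) = (\<mu> * cnj \<mu>) * (\<phi> (Suc m) * cnj (\<phi> m))" for m
    using fl[of m] fl[of "Suc m"] by simp
  then have "E (n + T) = E T + E n" for n
    using sum_shift_period[of "\<lambda>m. Re (\<phi> (Suc m) * cnj (\<phi> m))" T 1 n]
    by (simp only: E_def mu mult_1_left)
  moreover have "E T = C_coeff \<phi> T"
    by (simp add: E_def C_coeff_def sum.atLeast1_atMost_eq del: times_complex.sel)
  \<comment> \<open>\<open>E\<close> gains the same amount \<open>C_coeff \<phi> T\<close> in every
    period, so removing the linear trend leaves a periodic sequence.\<close>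
  ultimately have "E (n + T) - C_coeff \<phi> T / T * real (n + T) = E n - C_coeff \<phi> T / T * n" for n
    using \<open>T \<ge> 1\<close> by (simp add: distrib_left)
  from periodic_bounded[where f = "\<lambda>n. E n - C_coeff \<phi> T / T * n", OF \<open>T \<ge> 1\<close> this]
  obtain B1 where B1: "\<And>n. \<bar>E n - C_coeff \<phi> T / T * n\<bar> \<le> B1" by blast
  have "\<phi> (Suc (m + T)) * \<phi> (m + T) = (\<mu> * \<mu>) * (\<phi> (Suc m) * \<phi> m)" for m
    using fl[of m] fl[of "Suc m"] by simp
  then have "H (n + T) = H T + \<mu> * \<mu> * H n" for n
    unfolding H_def by (rule sum_shift_period)
  moreover have "H T = h - \<mu> * \<mu> * h"
  proof -
    have "H T = h * (1 - \<mu> * \<mu>)" using \<open>\<mu> * \<mu> \<noteq> 1\<close> by (simp add: h_def)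
    then show ?thesis by (simp add: algebra_simps)
  qed
  ultimately have "H (n + T) - h = \<mu> * \<mu> * (H n - h)" for n
    by (simp only: right_diff_distrib) simp
  then have "cmod (H (n + T) - h) = cmod (H n - h)" for n
    using \<open>cmod \<mu> = 1\<close> by (simp add: norm_mult)
  from periodic_bounded[where f = "\<lambda>n. cmod (H n - h)", OF \<open>T \<ge> 1\<close> this]
  obtain B2 where B2: "\<And>n. cmod (H n - h) \<le> B2" by auto
  show thesis
  proof (rule that)
    fix n
    \<comment> \<open>The factor 1/2 here is the source of the 2 in the mean value
      \<open>C_coeff \<phi> T / (2 * real T)\<close>.\<close>
    have im: "Im z * Im w = (Re (z * cnj w) - Re (z * w)) / 2" for z w by simp
    have "(\<Sum>m<n. Im (\<phi> (Suc m)) * Im (\<phi> m)) = (E n - Re (H n)) / 2"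
      by (simp only: im E_def H_def sum_subtractf sum_divide_distrib[symmetric] Re_sum)
    then have "(\<Sum>m<n. Im (\<phi> (Suc m)) * Im (\<phi> m) - C_coeff \<phi> T / (2 * real T))
        = (E n - C_coeff \<phi> T / T * n) / 2 - Re (H n - h) / 2 - Re h / 2"
      by (simp add: sum_subtractf diff_divide_distrib mult_ac)
    moreover have "\<bar>Re (H n - h)\<bar> \<le> B2" "\<bar>Re h\<bar> \<le> cmod h"
      using B2[of n] abs_Re_le_cmod[of "H n - h"] abs_Re_le_cmod[of h] by auto
    ultimately show "\<bar>\<Sum>m<n. Im (\<phi> (Suc m)) * Im (\<phi> m) - C_coeff \<phi> T / (2 * real T)\<bar>
        \<le> (B1 + B2 + cmod h) / 2"
      using B1[of n] by argo
  qed
qed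

section \<open>Tails of weighted series\<close>

lemma abel_partial_sum:
  fixes b h :: "nat \<Rightarrow> real"
  shows "(\<Sum>k<N. b k * h k) = b N * (\<Sum>k<N. h k) + (\<Sum>k<N. (b k - b (Suc k)) * (\<Sum>j\<le>k. h j))"
  by (induction N) (simp_all add: algebra_simps lessThan_Suc_atMost[symmetric])

text \<open>After summation by parts the weights \<open>b k - b (Suc k)\<close> are nonnegative and
  telescope to \<open>b 0 - b N\<close>; the boundary term contributes the missing
  \<open>b N\<close>.\<close>

lemma abel_bound:
  fixes b h :: "nat \<Rightarrow> real"
  assumes "decseq b" and "\<And>k. b k \<ge> 0" and B: "\<And>N. \<bar>\<Sum>k<N. h k\<bar> \<le> B"
  shows "\<bar>\<Sum>k<N. b k * h k\<bar> \<le> B * b 0"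
proof -
  have "\<bar>\<Sum>k<N. b k * h k\<bar> \<le> b N * B + (\<Sum>k<N. (b k - b (Suc k)) * B)"
  proof (subst abel_partial_sum, rule order.trans[OF abs_triangle_ineq add_mono])
    show "\<bar>b N * (\<Sum>k<N. h k)\<bar> \<le> b N * B"
      using assms(2)[of N] B[of N] by (simp add: abs_mult mult_left_mono)
    show "\<bar>\<Sum>k<N. (b k - b (Suc k)) * (\<Sum>j\<le>k. h j)\<bar> \<le> (\<Sum>k<N. (b k - b (Suc k)) * B)"
    proof (rule order.trans[OF sum_abs sum_mono])
      fix k
      have "b k - b (Suc k) \<ge> 0" using assms(1) by (simp add: decseq_Suc_iff)
      then show "\<bar>(b k - b (Suc k)) * (\<Sum>j\<le>k. h j)\<bar> \<le> (b k - b (Suc k)) * B"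
        using B[of "Suc k"] by (simp add: abs_mult mult_left_mono lessThan_Suc_atMost)
    qed
  qed
  also have "(\<Sum>k<N. (b k - b (Suc k)) * B) = (b 0 - b N) * B"
    by (simp add: sum_lessThan_telescope' flip: sum_distrib_right)
  finally show ?thesis by (simp add: algebra_simps)
qed

section \<open>Two-sided bounds for tails of the power series\<close>

lemma summable_powr_shift:
  fixes \<alpha> :: real
  assumes "\<alpha> > 1"
  shows "summable (\<lambda>k. real (n + k) powr (- \<alpha>))"
  using summable_ignore_initial_segment[of "\<lambda>k. real k powr (- \<alpha>)" n] assms
  by (simp add: summable_real_powr_iff add.commute)

text \<open>Only the first \<open>n\<close> terms are kept; their indices are at most
  \<open>2 * n\<close>.\<close>

lemma powr_tail_lower:
  fixes \<alpha> :: real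
  assumes "\<alpha> > 1" and "n \<ge> 1"
  shows "real n * (2 * real n) powr (- \<alpha>) \<le> (\<Sum>k. real (n + 1 + k) powr (- \<alpha>))"
proof -
  have "real n * (2 * real n) powr (- \<alpha>) = (\<Sum>k<n. (2 * real n) powr (- \<alpha>))" by simp
  also have "\<dots> \<le> (\<Sum>k<n. real (n + 1 + k) powr (- \<alpha>))"
    using assms by (intro sum_mono powr_mono2') auto
  also have "\<dots> \<le> (\<Sum>k. real (n + 1 + k) powr (- \<alpha>))"
    using summable_powr_shift[OF assms(1), of "n + 1"] by (intro sum_le_suminf) auto
  finally show ?thesis .
qed

text \<open>The mean value theorem for the power with exponent \<open>1 - \<alpha>\<close>, in place
  of an integral comparison. It makes the upper bound for the tail telescope.\<close>

lemma powr_diff_ge: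
  fixes \<alpha> x :: real
  assumes "\<alpha> > 1" and "x > 0"
  shows "(\<alpha> - 1) * (x + 1) powr (- \<alpha>) \<le> x powr (1 - \<alpha>) - (x + 1) powr (1 - \<alpha>)"
proof -
  have "\<exists>z. x < z \<and> z < x + 1 \<and>
      (x + 1) powr (1 - \<alpha>) - x powr (1 - \<alpha>) = (x + 1 - x) * ((1 - \<alpha>) * z powr (- \<alpha>))"
    using assms by (intro MVT2) (auto intro!: derivative_eq_intros)
  then obtain z where z: "x < z" "z < x + 1"
    and eq: "x powr (1 - \<alpha>) - (x + 1) powr (1 - \<alpha>) = (\<alpha> - 1) * z powr (- \<alpha>)"
    by (auto simp: algebra_simps)
  have "(x + 1) powr (- \<alpha>) \<le> z powr (- \<alpha>)"
    using z assms by (intro powr_mono2') auto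
  then show ?thesis unfolding eq using assms by simp
qed

lemma powr_tail_upper:
  fixes \<alpha> :: real
  assumes "\<alpha> > 1" and "n \<ge> 1"
  shows "(\<Sum>k. real (n + 1 + k) powr (- \<alpha>)) \<le> real n powr (1 - \<alpha>) / (\<alpha> - 1)"
proof (rule suminf_le_const[OF summable_powr_shift[OF assms(1)]])
  fix N
  have "(\<alpha> - 1) * (\<Sum>k<N. real (n + 1 + k) powr (- \<alpha>))
      \<le> (\<Sum>k<N. real (n + k) powr (1 - \<alpha>) - real (n + Suc k) powr (1 - \<alpha>))"
    unfolding sum_distrib_left
  proof (rule sum_mono)
    fix k
    show "(\<alpha> - 1) * real (n + 1 + k) powr (- \<alpha>)
        \<le> real (n + k) powr (1 - \<alpha>) - real (n + Suc k) powr (1 - \<alpha>)"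
      using powr_diff_ge[OF assms(1), of "real (n + k)"] assms(2) by (simp add: algebra_simps)
  qed
  also have "\<dots> = real n powr (1 - \<alpha>) - real (n + N) powr (1 - \<alpha>)"
    by (subst sum_lessThan_telescope') simp
  also have "\<dots> \<le> real n powr (1 - \<alpha>)" by simp
  finally show "(\<Sum>k<N. real (n + 1 + k) powr (- \<alpha>)) \<le> real n powr (1 - \<alpha>) / (\<alpha> - 1)"
    using assms by (simp add: field_simps)
qed

text \<open>If the tail from \<open>n\<close> vanished, \<open>\<kappa>\<close> times the tail of
  the weights would equal, up to sign, the weighted sum of the fluctuations
  \<open>g - \<kappa>\<close>. The former has size at least of order n^(1-\<alpha>), the latter is
  O(n^(-\<alpha>)) by Abel summation.\<close>

lemma weighted_tail_nonzero:
  fixes g :: "nat \<Rightarrow> real"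
  assumes "\<alpha> > 1" and "\<kappa> \<noteq> 0" and B: "\<And>n. \<bar>\<Sum>m<n. g m - \<kappa>\<bar> \<le> B"
    and sm: "\<And>n. summable (\<lambda>k. real (n + 1 + k) powr (- \<alpha>) * g (n + k))"
  shows "\<exists>L. \<forall>n\<ge>L. (\<Sum>k. real (n + 1 + k) powr (- \<alpha>) * g (n + k)) \<noteq> 0"
proof -
  \<comment> \<open>This is the contradiction between the two bounds after cancelling
    \<open>real n powr (- \<alpha>)\<close>.\<close>
  have "eventually (\<lambda>n. real n * (\<bar>\<kappa>\<bar> * 2 powr (- \<alpha>)) > 2 * B) sequentially"
    using \<open>\<kappa> \<noteq> 0\<close> by real_asymp
  then obtain L where L: "\<And>n. n \<ge> L \<Longrightarrow> real n * (\<bar>\<kappa>\<bar> * 2 powr (- \<alpha>)) > 2 * B"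
    by (auto simp: eventually_sequentially)
  have "(\<Sum>k. real (n + 1 + k) powr (- \<alpha>) * g (n + k)) \<noteq> 0" if n: "n \<ge> max 1 L" for n
  proof
    assume zero: "(\<Sum>k. real (n + 1 + k) powr (- \<alpha>) * g (n + k)) = 0"
    define b where "b k = real (n + 1 + k) powr (- \<alpha>)" for k
    have smb: "summable b" unfolding b_def using summable_powr_shift[OF \<open>\<alpha> > 1\<close>] .
    have "(\<lambda>k. b k * g (n + k)) sums 0"
      using summable_sums[OF sm[of n]] zero by (simp add: b_def)
    then have "(\<lambda>k. b k * g (n + k) - b k * \<kappa>) sums (0 - suminf b * \<kappa>)"
      using sums_mult2[OF summable_sums[OF smb]] by (rule sums_diff)
    then have lim: "(\<lambda>N. \<bar>\<Sum>k<N. b k * (g (n + k) - \<kappa>)\<bar>) \<longlonglongrightarrow> \<bar>suminf b * \<kappa>\<bar>"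
      using tendsto_rabs by (fastforce simp: sums_def right_diff_distrib)
    have "decseq b"
      unfolding b_def decseq_def using \<open>\<alpha> > 1\<close> by (auto intro!: powr_mono2')
    \<comment> \<open>A block starting at \<open>n\<close> is a difference of two initial sums,
      hence the factor 2.\<close>
    have part: "\<bar>\<Sum>k<N. g (n + k) - \<kappa>\<bar> \<le> 2 * B" for N
    proof -
      have "(\<Sum>m<n + N. g m - \<kappa>) = (\<Sum>m<n. g m - \<kappa>) + (\<Sum>k<N. g (n + k) - \<kappa>)"
        by (induction N) simp_all
      then show ?thesis using B[of n] B[of "n + N"] by linarith
    qed
    have "\<bar>\<Sum>k<N. b k * (g (n + k) - \<kappa>)\<bar> \<le> 2 * B * b 0" for N
      by (rule abel_bound[OF \<open>decseq b\<close> _ part]) (simp add: b_def)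
    then have "\<bar>suminf b * \<kappa>\<bar> \<le> 2 * B * b 0"
      by (intro LIMSEQ_le_const2[OF lim]) auto
    moreover have "real n * (2 * real n) powr (- \<alpha>) \<le> suminf b"
      unfolding b_def using powr_tail_lower[OF \<open>\<alpha> > 1\<close>] n by auto
    then have "real n * (2 * real n) powr (- \<alpha>) * \<bar>\<kappa>\<bar> \<le> \<bar>suminf b * \<kappa>\<bar>"
      by (simp add: abs_mult mult_right_mono)
    moreover have "B \<ge> 0" using B[of 0] by simp
    then have "2 * B * b 0 \<le> 2 * B * real n powr (- \<alpha>)"
      using n \<open>\<alpha> > 1\<close> by (intro mult_left_mono) (auto simp: b_def intro!: powr_mono2')
    ultimately have "real n * (\<bar>\<kappa>\<bar> * 2 powr (- \<alpha>)) * real n powr (- \<alpha>) \<le> 2 * B * real n powr (- \<alpha>)"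
      by (simp add: powr_mult algebra_simps)
    then show False using L[of n] n by (simp add: not_le)
  qed
  then show ?thesis by blast
qed

section \<open>The tails $\omega_n$\<close>

lemma omega_eq_of_tail:
  assumes "\<And>m. m > n \<Longrightarrow> c m = d m"
  shows "omega c \<alpha> \<phi> n = omega d \<alpha> \<phi> n"
  unfolding omega_def using assms by simp

lemma omega_summable:
  assumes "\<alpha> > 1" and "\<And>n. cmod (\<phi> n) \<le> K" and c: "\<forall>m\<ge>L. c m = 1"
  shows "summable (\<lambda>k. c (n + 1 + k) * real (n + 1 + k) powr (- \<alpha>) * Im (\<phi> (n + 1 + k)) * Im (\<phi> (n + k)))"
proof (rule summable_comparison_test')
  show "summable (\<lambda>k. real (n + 1 + k) powr (- \<alpha>) * (K * K))"
    using summable_mult2[OF summable_powr_shift[OF assms(1)]] .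
  \<comment> \<open>The factors before \<open>L\<close> are arbitrary, so the comparison is made
    only where \<open>c\<close> is 1.\<close>
  fix k assume "k \<ge> L"
  then have "c (n + 1 + k) = 1" using c by simp
  moreover have "\<bar>Im (\<phi> m)\<bar> \<le> K" for m using assms(2)[of m] abs_Im_le_cmod order.trans by blast
  then have "\<bar>Im (\<phi> (n + 1 + k))\<bar> * \<bar>Im (\<phi> (n + k))\<bar> \<le> K * K"
    by (intro mult_mono) (auto intro: order.trans[OF abs_ge_zero])
  ultimately show "norm (c (n + 1 + k) * real (n + 1 + k) powr (- \<alpha>) * Im (\<phi> (n + 1 + k)) * Im (\<phi> (n + k)))
      \<le> real (n + 1 + k) powr (- \<alpha>) * (K * K)"
    by (simp add: abs_mult mult.assoc mult_left_mono)
qed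

lemma omega_Suc:
  assumes "\<alpha> > 1" and "\<And>n. cmod (\<phi> n) \<le> K" and "\<forall>m\<ge>L. c m = 1"
  shows "omega c \<alpha> \<phi> n = omega c \<alpha> \<phi> (Suc n)
    + c (Suc n) * real (Suc n) powr (- \<alpha>) * Im (\<phi> (Suc n)) * Im (\<phi> n)"
  using suminf_split_head[OF omega_summable[where \<phi> = \<phi>, OF assms, of n]] by (simp add: omega_def)

lemma omega_bound:
  assumes "\<alpha> > 1" and K: "\<And>n. cmod (\<phi> n) \<le> K" and "\<forall>m\<ge>L. c m = 1" and "n \<ge> L" and "n \<ge> 1"
  shows "\<bar>omega c \<alpha> \<phi> n\<bar> \<le> K * K / (\<alpha> - 1) * real n powr (1 - \<alpha>)"
proof -
  have sm: "summable (\<lambda>k. real (n + 1 + k) powr (- \<alpha>) * (K * K))"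
    using summable_mult2[OF summable_powr_shift[OF assms(1)]] .
  have "\<bar>Im (\<phi> m)\<bar> \<le> K" for m using K[of m] abs_Im_le_cmod order.trans by blast
  then have "\<bar>Im (\<phi> (n + 1 + k))\<bar> * \<bar>Im (\<phi> (n + k))\<bar> \<le> K * K" for k
    by (intro mult_mono) (auto intro: order.trans[OF abs_ge_zero])
  then have "norm (omega c \<alpha> \<phi> n) \<le> (\<Sum>k. real (n + 1 + k) powr (- \<alpha>) * (K * K))"
    unfolding omega_def using assms
    by (intro norm_suminf_le[OF _ sm]) (simp add: abs_mult mult.assoc mult_left_mono)
  also have "\<dots> = (\<Sum>k. real (n + 1 + k) powr (- \<alpha>)) * (K * K)"
    using suminf_mult2[OF summable_powr_shift[OF assms(1)]] by metis
  also have "\<dots> \<le> real n powr (1 - \<alpha>) / (\<alpha> - 1) * (K * K)"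
    using powr_tail_upper[OF assms(1,5)] by (rule mult_right_mono) simp
  finally show ?thesis by (simp add: mult.commute)
qed

lemma omega_eventually_nonzero:
  assumes "\<alpha> > 1" and "T \<ge> 1" and fl: "\<And>n. \<phi> (n + T) = \<mu> * \<phi> n" and "cmod \<mu> = 1"
    and "\<mu> * \<mu> \<noteq> 1" and "C_coeff \<phi> T \<noteq> 0"
  shows "\<exists>L. \<forall>n\<ge>L. omega (\<lambda>_. 1) \<alpha> \<phi> n \<noteq> 0"
proof -
  let ?\<kappa> = "C_coeff \<phi> T / (2 * real T)"
  let ?g = "\<lambda>m. Im (\<phi> (Suc m)) * Im (\<phi> m)"
  obtain K where K: "\<And>n. cmod (\<phi> n) \<le> K"
    using floquet_bounded[where \<phi> = \<phi>, OF \<open>T \<ge> 1\<close> fl \<open>cmod \<mu> = 1\<close>] by blast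
  obtain B where B: "\<And>n. \<bar>\<Sum>m<n. ?g m - ?\<kappa>\<bar> \<le> B"
    using floquet_im_partial_sums[where \<phi> = \<phi>, OF assms(2-5)] by blast
  have "summable (\<lambda>k. real (n + 1 + k) powr (- \<alpha>) * ?g (n + k))" for n
    using omega_summable[where \<phi> = \<phi> and c = "\<lambda>_. 1" and L = 0 and n = n, OF \<open>\<alpha> > 1\<close> K] by (simp add: mult.assoc)
  from weighted_tail_nonzero[OF \<open>\<alpha> > 1\<close> _ B this] show ?thesis
    using assms by (simp add: omega_def mult.assoc)
qed

text \<open>All early factors can be taken to be \<open>0\<close>, which freezes $\omega_n$ at a nonvanishing tail.\<close>

lemma admissible_factors_exist:
  assumes "\<alpha> > 1" and K: "\<And>n. cmod (\<phi> n) \<le> K"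
    and nz: "\<forall>n\<ge>L. omega (\<lambda>_. 1) \<alpha> \<phi> n \<noteq> 0"
  shows "\<exists>c. admissible_factors \<alpha> \<phi> c"
proof (cases "\<forall>n\<ge>1. omega (\<lambda>_. 1) \<alpha> \<phi> n \<noteq> 0")
  case True
  then show ?thesis by (auto simp: admissible_factors_def)
next
  case False
  \<comment> \<open>The tail at \<open>L\<close> involves only factors of index above
    \<open>L\<close>, so the zeros may extend up to and including \<open>L\<close>.\<close>
  obtain c :: "nat \<Rightarrow> real" where c: "\<And>m. c m = (if m > L then 1 else 0)"
    by (rule that[of "\<lambda>m. if m > L then 1 else 0"]) simp
  have late: "omega c \<alpha> \<phi> n \<noteq> 0" if "n \<ge> L" for n
    using nz that omega_eq_of_tail[of n c "\<lambda>_. 1"] by (simp add: c)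
  have freeze: "omega c \<alpha> \<phi> n = omega c \<alpha> \<phi> (Suc n)" if "n < L" for n
    using omega_Suc[where \<phi> = \<phi> and c = c and L = "Suc L" and n = n, OF \<open>\<alpha> > 1\<close> K] that
    by (simp add: c)
  have "omega c \<alpha> \<phi> n \<noteq> 0" for n
  proof (cases "n \<ge> L")
    case False
    have "omega c \<alpha> \<phi> n = omega c \<alpha> \<phi> L"
      by (rule inc_induct[where P = "\<lambda>k. omega c \<alpha> \<phi> k = omega c \<alpha> \<phi> L" and i = n and j = L])
        (use False in \<open>simp_all add: freeze\<close>)
    with late show ?thesis by simp
  qed (use late in auto)
  with False show ?thesis
    \<comment> \<open>Since \<open>c L = 0\<close>, the threshold witnessing admissibility is
      \<open>Suc L\<close>.\<close>
    using nz by (auto simp: admissible_factors_def c intro!: exI[of _ c] exI[of _ "Suc L"])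
qed

text \<open>Merges both cases of the convention: without modification \<open>c\<close> is constantly
  1 and any \<open>L\<close> serves.\<close>

lemma admissible_factorsD:
  assumes "admissible_factors \<alpha> \<phi> c"
  obtains L where "\<forall>m\<ge>L. c m = 1" and "\<forall>n\<ge>1. omega c \<alpha> \<phi> n \<noteq> 0"
  using assms by (auto simp: admissible_factors_def split: if_splits)

section \<open>The eigenvector\<close>

text \<open>The bound on \<open>\<alpha>\<close> says exactly that
  \<open>2 * (1 - \<alpha>) < -1\<close>. Comparison starts at index 2 or later, so
  \<open>u1\<close> stays arbitrary.\<close>

lemma u_seq_in_l2:
  assumes "\<alpha> > 3 / 2" and K: "\<And>n. cmod (\<phi> n) \<le> K" and c: "\<forall>m\<ge>L. c m = 1"
  shows "u_seq c \<alpha> \<phi> u1 \<in> l2"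
proof -
  let ?D = "K * K / (\<alpha> - 1) * K"
  have "summable (\<lambda>n. ?D\<^sup>2 * real n powr (2 * (1 - \<alpha>)))"
    using assms by (intro summable_mult) (simp add: summable_real_powr_iff)
  then have "summable (\<lambda>n. (cmod (u_seq c \<alpha> \<phi> u1 n))\<^sup>2)"
  proof (rule summable_comparison_test'[where N = "max 2 L"])
    fix n assume n: "n \<ge> max 2 L"
    have "\<bar>omega c \<alpha> \<phi> n\<bar> * \<bar>Im (\<phi> n)\<bar> \<le> (K * K / (\<alpha> - 1) * real n powr (1 - \<alpha>)) * K"
      using omega_bound[where \<phi> = \<phi>, OF _ K c, of \<alpha> n] n assms K[of n] abs_Im_le_cmod[of "\<phi> n"]
      by (intro mult_mono) (auto intro: order.trans[OF abs_Im_le_cmod])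
    then have "(\<bar>omega c \<alpha> \<phi> n\<bar> * \<bar>Im (\<phi> n)\<bar>)\<^sup>2 \<le> (?D * real n powr (1 - \<alpha>))\<^sup>2"
      by (intro power_mono) (auto simp: algebra_simps)
    also have "\<dots> = ?D\<^sup>2 * real n powr (2 * (1 - \<alpha>))"
      by (simp add: power_mult_distrib power2_eq_square flip: powr_add)
    finally show "norm ((cmod (u_seq c \<alpha> \<phi> u1 n))\<^sup>2) \<le> ?D\<^sup>2 * real n powr (2 * (1 - \<alpha>))"
      using n by (simp add: u_seq_def abs_mult norm_mult)
  qed
  then show ?thesis by (simp add: l2_def u_seq_def)
qed

text \<open>Expressing \<open>w n\<close> and \<open>w (n + 2)\<close> through
  \<open>w (Suc n)\<close> produces two correction terms. The potential is designed to cancel them,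
  which leaves \<open>w (Suc n)\<close> times the recurrence for \<open>s\<close>.\<close>

lemma eigenvalue_equation_tail:
  fixes a s w t :: "nat \<Rightarrow> real"
  assumes s: "a n * s n + a (Suc n) * s (n + 2) = l * s (Suc n)"
    and w: "w n = w (Suc n) + t (Suc n) * s (Suc n) * s n"
      "w (Suc n) = w (n + 2) + t (n + 2) * s (n + 2) * s (Suc n)" and "w (Suc n) \<noteq> 0"
  shows "a n * (w n * s n) + a (Suc n) * (w (n + 2) * s (n + 2))
    + (- a n * (s n)\<^sup>2 * (t (Suc n) / w (Suc n)) + a (Suc n) * (s (n + 2))\<^sup>2 * (t (n + 2) / w (Suc n)))
        * (w (Suc n) * s (Suc n)) = l * (w (Suc n) * s (Suc n))"
proof -
  have "(x / w (Suc n)) * (w (Suc n) * y) = x * y" for x y using assms by simp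
  then have "(- a n * (s n)\<^sup>2 * (t (Suc n) / w (Suc n)) + a (Suc n) * (s (n + 2))\<^sup>2 * (t (n + 2) / w (Suc n)))
        * (w (Suc n) * s (Suc n))
      = - a n * (s n)\<^sup>2 * (t (Suc n) * s (Suc n)) + a (Suc n) * (s (n + 2))\<^sup>2 * (t (n + 2) * s (Suc n))"
    by (simp only: distrib_right mult.assoc)
  moreover have "a n * (w n * s n) + a (Suc n) * (w (n + 2) * s (n + 2))
      - a n * (s n)\<^sup>2 * (t (Suc n) * s (Suc n)) + a (Suc n) * (s (n + 2))\<^sup>2 * (t (n + 2) * s (Suc n))
      = w (Suc n) * (a n * s n + a (Suc n) * s (n + 2))"
    \<comment> \<open>Both sides are rewritten in terms of \<open>w (n + 2)\<close>, after which the
      claim is a polynomial identity.\<close>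
    unfolding w(1) by (subst (1 2) w(2)) (simp add: algebra_simps power2_eq_square)
  ultimately show ?thesis unfolding s by (simp only: mult_ac)
qed

lemma l2_eigenvector_u_seq:
  fixes l :: real
  assumes pos: "\<And>n. a n > 0" and tt: "three_term a (of_real l) \<phi>"
    and "Im (\<phi> 0) = 0" and "Im (\<phi> 1) \<noteq> 0" and "\<alpha> > 3 / 2"
    and K: "\<And>n. cmod (\<phi> n) \<le> K" and c: "\<forall>m\<ge>L. c m = 1" and w0: "\<forall>n\<ge>1. omega c \<alpha> \<phi> n \<noteq> 0"
  shows "\<exists>u1 q1 q2 :: real.
    l2_eigenvector (perturbed_jacobi a (q_seq a c \<alpha> \<phi> q1 q2)) (u_seq c \<alpha> \<phi> u1) (of_real l)"
proof -
  define w where "w = omega c \<alpha> \<phi>"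
  define s where "s n = Im (\<phi> n)" for n
  define t where "t n = c n * real n powr (- \<alpha>)" for n
  have "\<alpha> > 1" using assms by simp
  have s_rec: "a n * s n + a (Suc n) * s (n + 2) = l * s (Suc n)" for n
    using arg_cong[OF tt[unfolded three_term_def, rule_format, of n], of Im] by (simp add: s_def)
  have w_rec: "w n = w (Suc n) + t (Suc n) * s (Suc n) * s n" for n
    using omega_Suc[where \<phi> = \<phi>, OF \<open>\<alpha> > 1\<close> K c, of n] by (simp add: w_def t_def s_def)
  have w_nz: "w n \<noteq> 0" if "n \<ge> 1" for n using w0 that by (simp add: w_def)
  have l2: "u_seq c \<alpha> \<phi> u1 \<in> l2" for u1 using u_seq_in_l2[where \<phi> = \<phi>, OF \<open>\<alpha> > 3 / 2\<close> K c] .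
  have tail: "perturbed_jacobi a (q_seq a c \<alpha> \<phi> q1 q2) (u_seq c \<alpha> \<phi> u1) n
      = of_real l * u_seq c \<alpha> \<phi> u1 n" if n: "n \<ge> 3" for u1 q1 q2 n
  proof -
    \<comment> \<open>Both neighbours of \<open>n\<close> then have index at least 2, where
      \<open>u_seq\<close> is given by the product formula.\<close>
    obtain m where m: "n = Suc m" "m \<ge> 2" using n by (cases n) auto
    have "a m * (w m * s m) + a (Suc m) * (w (m + 2) * s (m + 2))
      + (- a m * (s m)\<^sup>2 * (t (Suc m) / w (Suc m)) + a (Suc m) * (s (m + 2))\<^sup>2 * (t (m + 2) / w (Suc m)))
        * (w (Suc m) * s (Suc m)) = l * (w (Suc m) * s (Suc m))"
      using eigenvalue_equation_tail[of a m s l w t] s_rec[of m] w_rec[of m] w_rec[of "Suc m"] w_nz[of "Suc m"]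
      by simp
    from arg_cong[OF this, of complex_of_real] show ?thesis
      using m by (simp add: perturbed_jacobi_def jacobi_def diag_op_def u_seq_def q_seq_def
          w_def s_def t_def)
  qed
  have u2: "u_seq c \<alpha> \<phi> u1 2 = of_real (w 2 * s 2)" and u3: "u_seq c \<alpha> \<phi> u1 3 = of_real (w 3 * s 3)" for u1
    by (simp_all add: u_seq_def w_def s_def)
  \<comment> \<open>What remains are the scalar equations at sites 1 and 2 in the unknowns
    \<open>u1\<close>, \<open>q1\<close>, \<open>q2\<close>.\<close>
  have head: "perturbed_jacobi a (q_seq a c \<alpha> \<phi> q1 q2) (u_seq c \<alpha> \<phi> u1)
      = (\<lambda>n. of_real l * u_seq c \<alpha> \<phi> u1 n)"
    if 1: "a 1 * (w 2 * s 2) + q1 * u1 = l * u1"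
      and 2: "a 1 * u1 + a 2 * (w 3 * s 3) + q2 * (w 2 * s 2) = l * (w 2 * s 2)" for u1 q1 q2
  proof
    fix n :: nat
    consider "n = 0" | "n = 1" | "n = 2" | "n \<ge> 3" by linarith
    then show "perturbed_jacobi a (q_seq a c \<alpha> \<phi> q1 q2) (u_seq c \<alpha> \<phi> u1) n
      = of_real l * u_seq c \<alpha> \<phi> u1 n"
    proof cases
      assume "n = 1"
      with arg_cong[OF 1, of complex_of_real] show ?thesis
        by (simp add: perturbed_jacobi_def jacobi_def diag_op_def q_seq_def u2) (simp add: u_seq_def)
    next
      assume "n = 2"
      with arg_cong[OF 2, of complex_of_real] show ?thesis
        by (simp add: perturbed_jacobi_def jacobi_def diag_op_def q_seq_def u2 u3) (simp add: u_seq_def)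
    qed (use tail in \<open>auto simp: perturbed_jacobi_def jacobi_def diag_op_def u_seq_def\<close>)
  qed
  show ?thesis
  proof (cases "s 2 = 0")
    \<comment> \<open>Here the entry at 2 is nonzero: with \<open>u1 = 1\<close> the equation at
      site 1 determines \<open>q1\<close> and the one at site 2 determines
      \<open>q2\<close>.\<close>
    case False
    then have nz: "w 2 * s 2 \<noteq> 0" using w_nz by simp
    then have "u_seq c \<alpha> \<phi> 1 \<noteq> (\<lambda>_. 0)" using u2[of 1] by (metis of_real_eq_0_iff)
    moreover have "perturbed_jacobi a
        (q_seq a c \<alpha> \<phi> (l - a 1 * (w 2 * s 2)) (l - (a 1 + a 2 * (w 3 * s 3)) / (w 2 * s 2)))
        (u_seq c \<alpha> \<phi> 1) = (\<lambda>n. of_real l * u_seq c \<alpha> \<phi> 1 n)"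
      using nz by (intro head) (simp_all add: left_diff_distrib)
    ultimately show ?thesis using l2 unfolding l2_eigenvector_def by blast
  next
    \<comment> \<open>Now the entry at 2 is zero, so the equation at site 2 determines
      \<open>u1\<close> for every \<open>q2\<close>, and \<open>q1 = l\<close> settles site 1. The
      recurrence at site 2 makes \<open>s 3\<close> nonzero because \<open>s 1\<close> is, so the
      vector is nonzero at index 3.\<close>
    case True
    have "a 0 * s 0 + a 1 * s 2 = l * s 1" "a 1 * s 1 + a 2 * s 3 = l * s 2"
      using s_rec[of 0] s_rec[of 1] by (simp_all add: numeral_eq_Suc)
    with True have "a 2 * s 3 \<noteq> 0"
      using \<open>Im (\<phi> 1) \<noteq> 0\<close> pos[of 1] by (auto simp: s_def)
    then have "w 3 * s 3 \<noteq> 0" using w_nz[of 3] by simp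
    then have "u_seq c \<alpha> \<phi> u1 \<noteq> (\<lambda>_. 0)" for u1 using u3 by (metis of_real_eq_0_iff)
    moreover have "perturbed_jacobi a (q_seq a c \<alpha> \<phi> l 0)
        (u_seq c \<alpha> \<phi> (- a 2 * (w 3 * s 3) / a 1)) 
        = (\<lambda>n. of_real l * u_seq c \<alpha> \<phi> (- a 2 * (w 3 * s 3) / a 1) n)"
      using True pos[of 1] by (intro head) simp_all
    ultimately show ?thesis using l2 unfolding l2_eigenvector_def by blast
  qed
qed

theorem theorem7p1:
  fixes a :: "nat \<Rightarrow> real" and T :: nat and lam :: complex and \<alpha> \<theta> :: real
    and \<phi> :: "nat \<Rightarrow> complex"
  assumes "T \<ge> 1"
    and "\<forall>j\<in>{1..T}. a j > 0"
    and "\<forall>n. a (n + T) = a n"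
    and "lam \<in> elliptic_points a T"
    and "quasi_momentum a T lam \<theta>"
    and "\<phi> = bloch a T lam \<theta>"
    and "C_coeff \<phi> T \<noteq> 0"
    and "\<alpha> > 3 / 2"
  shows "(\<exists>c. admissible_factors \<alpha> \<phi> c) \<and>
    (\<forall>c. admissible_factors \<alpha> \<phi> c \<longrightarrow>
      (\<exists>u1 q1 q2 :: real.
         lam \<in> point_spectrum (perturbed_jacobi a (q_seq a c \<alpha> \<phi> q1 q2)) \<and>
         l2_eigenvector (perturbed_jacobi a (q_seq a c \<alpha> \<phi> q1 q2)) (u_seq c \<alpha> \<phi> u1) lam))"
proof -
  have per: "a (n + T) = a n" for n using assms(3) by simp
  \<comment> \<open>Positivity is given on one period; index 0 is covered by
    \<open>a 0 = a T\<close>, larger indices by descending one period.\<close>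
  have pos: "a n > 0" for n
  proof (induction n rule: less_induct)
    case (less n)
    consider "n = 0" | "n \<in> {1..T}" | "n > T" by fastforce
    then show ?case
    proof cases
      case 1
      then have "a n = a T" using per[of 0] by simp
      then show ?thesis using assms(1,2) by simp
    next
      case 3
      then show ?thesis using less[of "n - T"] per[of "n - T"] assms(1) by simp
    qed (use assms(2) in auto)
  qed
  then have nz: "a n \<noteq> 0" for n by (simp add: less_imp_neq[THEN not_sym])
  note ell = elliptic_bloch[where a = a, OF nz per assms(1,4,5), folded assms(6)]
  obtain K where K: "\<And>n. cmod (\<phi> n) \<le> K"
    using floquet_bounded[where \<phi> = \<phi>, OF assms(1) ell(3)] by auto
  obtain l where l: "lam = of_real l" using ell(1) by (auto elim: Reals_cases)
  have "\<exists>L. \<forall>n\<ge>L. omega (\<lambda>_. 1) \<alpha> \<phi> n \<noteq> 0"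
    using omega_eventually_nonzero[where \<phi> = \<phi>, OF _ assms(1) ell(3) _ ell(2) assms(7)] assms(8) by simp
  then have "\<exists>c. admissible_factors \<alpha> \<phi> c" using admissible_factors_exist[where \<phi> = \<phi>, OF _ K] assms(8) by auto
  moreover have "\<exists>u1 q1 q2 :: real.
      l2_eigenvector (perturbed_jacobi a (q_seq a c \<alpha> \<phi> q1 q2)) (u_seq c \<alpha> \<phi> u1) lam"
    if "admissible_factors \<alpha> \<phi> c" for c
  proof -
    obtain L where "\<forall>m\<ge>L. c m = 1" "\<forall>n\<ge>1. omega c \<alpha> \<phi> n \<noteq> 0"
      using admissible_factorsD[OF \<open>admissible_factors \<alpha> \<phi> c\<close>] .
    moreover have "three_term a (of_real l) \<phi>"
      using three_term_bloch[OF nz] by (simp add: assms(6) l)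
    ultimately show ?thesis
      unfolding l using ell(4) assms(6,8) by (intro l2_eigenvector_u_seq[where \<phi> = \<phi>, OF pos _ _ _ _ K]) auto
  qed
  ultimately show ?thesis unfolding point_spectrum_def by blast
qed

end
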